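(* For every $x=(x_n)_{n\ge1}\in H=\ell^2$ that is positive, i.e. $x_n\ge0$ for all $n\ge1$, there exists a unique global solution $X$ of the dyadic system $$\frac{d}{dt}X_n(t)=k_{n-1}X_{n-1}^2(t)-k_nX_n(t)X_{n+1}(t),\qquad t\ge 0,\qquad X_n(0)=x_n,\qquad n\ge 1,$$ and this solution is a Leray-Hopf solution.
   Context: Standing assumptions: $(k_n)_{n\ge0}$ is a fixed real sequence with $k_0=0$ and $0\le k_n\le C2^n$ for all $n\ge1$, for some constant $C$; by convention $X_0(t)=0$ for all $t\ge0$. $H=\ell^2$ is the space of real square-summable sequences indexed by $n\ge1$, with its usual norm $\|\cdot\|_H$. A solution on $[0,T)$ (global solution if $T=+\infty$) with initial condition $x$ is a function $X=(X_n)_{n\ge1}$ defined on $[0,T)$ such that $X_n\in C^1([0,T))$ for all $n\ge1$, the system of equations holds for all $n\ge1$ with $X_n(0)=x_n$, and $X(t)\in H$ for all $t\in[0,T)$. A Leray-Hopf solution is a solution satisfying the strong energy inequality: $\|X(s)\|_H\ge\|X(t)\|_H$ for all $s,t\in[0,T)$ with $s<t$. *)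

theory Defs
  imports "HOL-Analysis.Analysis"
begin

text \<open>Sequences indexed by \<open>n \<ge> 1\<close> are modelled as functions on \<open>nat\<close>. The entry at index
  \<open>0\<close> belongs to neither the space \<open>\<ell>\<^sup>2\<close> nor its norm, hence the shifts by \<open>Suc\<close>.\<close>

definition ell2 :: "(nat \<Rightarrow> real) set" where
  "ell2 = {x. summable (\<lambda>n. (x (Suc n))\<^sup>2)}"

definition ell2_norm :: "(nat \<Rightarrow> real) \<Rightarrow> real" where
  "ell2_norm x = sqrt (\<Sum>n. (x (Suc n))\<^sup>2)"

definition time_interval :: "ereal \<Rightarrow> real set" where
  "time_interval T = {t. 0 \<le> t \<and> ereal t < T}"

text \<open>Derivatives are taken within the interval, so the one at the left end point \<open>0\<close> is
  one-sided. The library's \<open>C1_differentiable_on\<close> uses two-sided derivatives and would also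
  constrain the function to the left of \<open>0\<close>.\<close>

definition C1_within :: "real set \<Rightarrow> (real \<Rightarrow> real) \<Rightarrow> bool" where
  "C1_within I f \<longleftrightarrow>
     (\<exists>f'. (\<forall>t\<in>I. (f has_real_derivative f' t) (at t within I)) \<and> continuous_on I f')"

text \<open>\<open>X n t\<close> is \<open>X\<^sub>n(t)\<close>; its values for \<open>t\<close> outside the time interval are irrelevant. The
  condition on \<open>X 0\<close> is the convention \<open>X\<^sub>0 = 0\<close>.\<close>

definition dyadic_solution ::
  "(nat \<Rightarrow> real) \<Rightarrow> ereal \<Rightarrow> (nat \<Rightarrow> real) \<Rightarrow> (nat \<Rightarrow> real \<Rightarrow> real) \<Rightarrow> bool" where
  "dyadic_solution k T x X \<longleftrightarrow>
     (\<forall>t\<in>time_interval T. X 0 t = 0) \<and>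
     (\<forall>n\<ge>1. C1_within (time_interval T) (X n)) \<and>
     (\<forall>n\<ge>1. \<forall>t\<in>time_interval T.
        (X n has_real_derivative
           (k (n - 1) * (X (n - 1) t)\<^sup>2 - k n * X n t * X (n + 1) t))
        (at t within time_interval T)) \<and>
     (\<forall>n\<ge>1. X n 0 = x n) \<and>
     (\<forall>t\<in>time_interval T. (\<lambda>n. X n t) \<in> ell2)"

abbreviation global_solution ::
  "(nat \<Rightarrow> real) \<Rightarrow> (nat \<Rightarrow> real) \<Rightarrow> (nat \<Rightarrow> real \<Rightarrow> real) \<Rightarrow> bool" where
  "global_solution k \<equiv> dyadic_solution k \<infinity>"

definition leray_hopf_solution ::
  "(nat \<Rightarrow> real) \<Rightarrow> ereal \<Rightarrow> (nat \<Rightarrow> real) \<Rightarrow> (nat \<Rightarrow> real \<Rightarrow> real) \<Rightarrow> bool" where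
  "leray_hopf_solution k T x X \<longleftrightarrow>
     dyadic_solution k T x X \<and>
     (\<forall>s\<in>time_interval T. \<forall>t\<in>time_interval T. s < t \<longrightarrow>
        ell2_norm (\<lambda>n. X n s) \<ge> ell2_norm (\<lambda>n. X n t))"

end

theory Submission
  imports Defs
begin

text \<open>Everything rests on one estimate for the difference \<open>Z = X - Y\<close> of two positive solutions.
  In the time derivative of \<open>\<psi>\<^sub>p = (\<Sum>n\<le>p. Z\<^sub>n\<^sup>2 / 2\<^sup>n)\<close> all coupling terms but the one at level \<open>p\<close>
  cancel or have a favourable sign, and since \<open>k\<^sub>p \<le> C 2\<^sup>p\<close> the remaining one is at most
  \<open>C (X\<^sub>p\<^sup>2 + Y\<^sub>p\<^sup>2) B\<close>, where \<open>B\<close> is the norm of the initial datum. Positivity makes the partial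
  energies nonincreasing, so the sum of these terms over all \<open>p\<close> is bounded by \<open>2 C B\<^sup>3\<close>; as \<open>\<psi>\<^sub>p\<close>
  increases with \<open>p\<close>, this forces \<open>(N - n) Z\<^sub>n(t)\<^sup>2 \<le> 2\<^sup>n \<cdot> 2 C B\<^sup>3 t\<close> for \<open>n \<le> N\<close>. Letting
  \<open>N\<close> tend to infinity gives uniqueness. The estimate only uses the first \<open>N\<close> equations, so it also
  shows that the Galerkin approximations are locally uniformly Cauchy, which gives existence
  without compactness.\<close>

section \<open>Calculus on the half line\<close>

lemma at_within_atLeast_eq:
  fixes t b :: real
  assumes "a \<le> t" "t < b"
  shows "at t within {a..} = at t within {a..b}"
  by (rule at_within_nhd[of _ "{..<b}"]) (use assms in auto)

lemma continuous_on_of_has_real_derivative: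
  fixes f :: "real \<Rightarrow> real"
  assumes "\<And>t. t \<in> S \<Longrightarrow> (f has_real_derivative f' t) (at t within S)"
  shows "continuous_on S f"
  unfolding continuous_on_eq_continuous_within using assms by (auto intro: DERIV_continuous)

lemma nondecreasing_within_atLeast:
  fixes f :: "real \<Rightarrow> real"
  assumes der: "\<And>t. t \<ge> 0 \<Longrightarrow> (f has_real_derivative f' t) (at t within {0..})"
    and nonneg: "\<And>u. s \<le> u \<Longrightarrow> u \<le> t \<Longrightarrow> f' u \<ge> 0"
    and "0 \<le> s" "s \<le> t"
  shows "f s \<le> f t"
proof (cases "s = t")
  case False
  then have "s < t" using assms by simp
  have "continuous_on {0..} f"
    by (rule continuous_on_of_has_real_derivative) (use der in auto)
  then have cont: "continuous_on {s..t} f"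
    by (rule continuous_on_subset) (use assms in auto)
  show ?thesis
  proof (rule DERIV_nonneg_imp_increasing_open[OF \<open>s \<le> t\<close> _ cont])
    fix u assume u: "s < u" "u < t"
    have "at u within {0..} = at u"
      by (rule at_within_interior) (use u assms in auto)
    then show "\<exists>y. (f has_real_derivative y) (at u) \<and> y \<ge> 0"
      using der[of u] nonneg[of u] u assms by auto
  qed
qed simp

lemma le_of_deriv_le:
  fixes f g :: "real \<Rightarrow> real"
  assumes "\<And>t. t \<ge> 0 \<Longrightarrow> (f has_real_derivative f' t) (at t within {0..})"
    and "\<And>t. t \<ge> 0 \<Longrightarrow> (g has_real_derivative g' t) (at t within {0..})"
    and "\<And>t. t \<ge> 0 \<Longrightarrow> f' t \<le> g' t"
    and "f 0 \<le> g 0" "t \<ge> 0"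
  shows "f t \<le> g t"
proof -
  have "g 0 - f 0 \<le> g t - f t"
    by (rule nondecreasing_within_atLeast[where f' = "\<lambda>t. g' t - f' t"])
      (use assms in \<open>auto intro!: DERIV_diff\<close>)
  then show ?thesis using assms(4) by simp
qed

lemma abs_le_of_abs_deriv_le:
  fixes f g :: "real \<Rightarrow> real"
  assumes f: "\<And>t. t \<ge> 0 \<Longrightarrow> (f has_real_derivative f' t) (at t within {0..})"
    and g: "\<And>t. t \<ge> 0 \<Longrightarrow> (g has_real_derivative g' t) (at t within {0..})"
    and le: "\<And>t. t \<ge> 0 \<Longrightarrow> \<bar>f' t\<bar> \<le> g' t"
    and "\<bar>f 0\<bar> \<le> g 0" "t \<ge> 0"
  shows "\<bar>f t\<bar> \<le> g t"
proof -
  have "f t \<le> g t"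
    by (rule le_of_deriv_le[OF f g]) (use assms in \<open>auto dest!: le\<close>)
  moreover have "- f t \<le> g t"
    by (rule le_of_deriv_le[OF DERIV_minus[OF f] g]) (use assms in \<open>auto dest!: le\<close>)
  ultimately show ?thesis by simp
qed

text \<open>Squaring removes the kink of \<open>max 0 y\<close> at \<open>0\<close>. Negative parts
  and, later, \<open>cutoff_energy\<close> can thus be differentiated by the chain rule.\<close>

lemma has_real_derivative_pos_part_square:
  "((\<lambda>y::real. (max 0 y)\<^sup>2) has_real_derivative 2 * max 0 y) (at y)"
proof -
  consider "y < 0" | "y > 0" | "y = 0" by linarith
  then show ?thesis
  proof cases
    case 1
    have "((\<lambda>y::real. 0) has_real_derivative 2 * max 0 y) (at y)" using 1 by simp
    then show ?thesis
      by (rule has_field_derivative_transform_within_open[of _ _ _ "{..<0}"]) (use 1 in auto)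
  next
    case 2
    have "((\<lambda>y::real. y\<^sup>2) has_real_derivative 2 * max 0 y) (at y)"
      using 2 by (auto intro!: derivative_eq_intros)
    then show ?thesis
      by (rule has_field_derivative_transform_within_open[of _ _ _ "{0<..}"]) (use 2 in auto)
  next
    case 3
    have "((\<lambda>h::real. (max 0 h)\<^sup>2 / h) \<longlongrightarrow> 0) (at 0)"
    proof (rule Lim_null_comparison)
      show "\<forall>\<^sub>F h::real in at 0. norm ((max 0 h)\<^sup>2 / h) \<le> \<bar>h\<bar>"
        by (rule always_eventually) (auto simp: max_def power2_eq_square)
    qed (auto intro!: tendsto_eq_intros)
    then show ?thesis
      using 3 by (simp add: DERIV_def)
  qed
qed

text \<open>A Gronwall argument for the squared negative part: \<open>exp (- 2 * B * s)\<close>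
  times the square of \<open>max 0 (- f s)\<close> starts at \<open>0\<close> and is nonincreasing,
  so it stays \<open>0\<close>. Where \<open>f\<close> is nonnegative this function has derivative
  \<open>0\<close>, hence the inequality is asked for only where \<open>f\<close> is
  negative.\<close>

lemma nonneg_of_deriv_ge:
  fixes f :: "real \<Rightarrow> real"
  assumes der: "\<And>t. t \<ge> 0 \<Longrightarrow> (f has_real_derivative f' t) (at t within {0..})"
    and ge: "\<And>s. 0 \<le> s \<Longrightarrow> s \<le> t \<Longrightarrow> f s < 0 \<Longrightarrow> f' s \<ge> B * f s"
    and "f 0 \<ge> 0" "t \<ge> 0"
  shows "f t \<ge> 0"
proof -
  define h where "h s = - (exp (- 2 * B * s) * (max 0 (- f s))\<^sup>2)" for s
  define h' where "h' s = - (- 2 * B * exp (- 2 * B * s) * (max 0 (- f s))\<^sup>2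
    + 2 * max 0 (- f s) * (- f' s) * exp (- 2 * B * s))" for s
  have "h 0 \<le> h t"
  proof (rule nondecreasing_within_atLeast[where f = h and f' = h'])
    fix s :: real assume s: "s \<ge> 0"
    have 1: "((\<lambda>s. exp (- 2 * B * s)) has_real_derivative - 2 * B * exp (- 2 * B * s))
        (at s within {0..})"
      by (auto intro!: derivative_eq_intros)
    have 2: "((\<lambda>s. (max 0 (- f s))\<^sup>2) has_real_derivative 2 * max 0 (- f s) * (- f' s))
        (at s within {0..})"
      by (rule DERIV_chain2[OF has_real_derivative_pos_part_square DERIV_minus[OF der[OF s]]])
    show "(h has_real_derivative h' s) (at s within {0..})"
      unfolding h_def[abs_def] h'_def by (rule DERIV_minus[OF DERIV_mult[OF 1 2]])
  next
    fix s :: real assume s: "0 \<le> s" "s \<le> t"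
    show "0 \<le> h' s"
    proof (cases "f s < 0")
      case True
      have "h' s = 2 * exp (- 2 * B * s) * ((- f s) * (f' s - B * f s))"
        using True unfolding h'_def by (simp add: power2_eq_square algebra_simps)
      also have "\<dots> \<ge> 0"
        using ge[OF s True] True by (intro mult_nonneg_nonneg) auto
      finally show ?thesis .
    qed (simp add: h'_def)
  qed (use assms in auto)
  also have "h 0 = 0" using assms by (simp add: h_def)
  finally have "(max 0 (- f t))\<^sup>2 \<le> 0"
    by (simp add: h_def h'_def mult_le_0_iff)
  then show ?thesis by simp
qed

section \<open>Limits of functions and of sequences\<close>

text \<open>Termwise differentiation on compact intervals. The derivatives are required only
  eventually, because a Galerkin approximation satisfies a given equation only once its order is
  large enough.\<close>

lemma has_real_derivative_local_uniform_limit: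
  fixes f f' :: "nat \<Rightarrow> real \<Rightarrow> real"
  assumes der: "\<forall>\<^sub>F N in sequentially. \<forall>t\<ge>0. (f N has_real_derivative f' N t) (at t within {0..})"
    and lim: "\<And>t. t \<ge> 0 \<Longrightarrow> (\<lambda>N. f N t) \<longlonglongrightarrow> g t"
    and lim': "\<And>T. T \<ge> 0 \<Longrightarrow> uniform_limit {0..T} f' g' sequentially"
    and "t \<ge> 0"
  shows "(g has_real_derivative g' t) (at t within {0..})"
proof -
  obtain N0 where N0: "\<And>N t. N \<ge> N0 \<Longrightarrow> t \<ge> 0 \<Longrightarrow>
      (f N has_real_derivative f' N t) (at t within {0..})"
    using der unfolding eventually_sequentially by blast
  \<comment> \<open>The shift by \<open>N0\<close> makes every member of the sequence
    differentiable, as \<open>has_derivative_sequence\<close> demands. The interval extends beyond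
    \<open>t\<close>, so that the derivative at \<open>t\<close> within it is the one within
    \<open>{0..}\<close>.\<close>
  have "\<exists>h. \<forall>x\<in>{0..t+1}. (\<lambda>N. f (N + N0) x) \<longlonglongrightarrow> h x \<and>
      (h has_derivative ((*) (g' x))) (at x within {0..t+1})"
  proof (rule has_derivative_sequence[where f' = "\<lambda>N x h. f' (N + N0) x * h"])
    fix N x assume "x \<in> {0..t+1}"
    then show "(f (N + N0) has_derivative (\<lambda>h. f' (N + N0) x * h)) (at x within {0..t+1})"
      using N0[of "N + N0" x]
      by (auto simp: has_field_derivative_def intro: has_derivative_subset)
  next
    fix e :: real assume "e > 0"
    have "uniform_limit {0..t+1} f' g' sequentially" using lim' \<open>t \<ge> 0\<close> by simp
    then have "\<forall>\<^sub>F N in sequentially. \<forall>x\<in>{0..t+1}. dist (f' N x) (g' x) < e"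
      using \<open>e > 0\<close> by (auto simp: uniform_limit_iff)
    then have "\<forall>\<^sub>F N in sequentially. \<forall>x\<in>{0..t+1}. dist (f' (N + N0) x) (g' x) < e"
      by (rule eventually_sequentially_seg[THEN iffD2])
    then show "\<forall>\<^sub>F N in sequentially. \<forall>x\<in>{0..t+1}. \<forall>h.
        norm (f' (N + N0) x * h - g' x * h) \<le> e * norm h"
    proof (rule eventually_mono, intro ballI allI)
      fix N x h assume "\<forall>x\<in>{0..t+1}. dist (f' (N + N0) x) (g' x) < e" "x \<in> {0..t+1}"
      then have "\<bar>f' (N + N0) x - g' x\<bar> \<le> e" by (auto simp: dist_real_def less_imp_le)
      then have "\<bar>f' (N + N0) x - g' x\<bar> * \<bar>h\<bar> \<le> e * \<bar>h\<bar>" by (rule mult_right_mono) simp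
      then show "norm (f' (N + N0) x * h - g' x * h) \<le> e * norm h"
        by (simp add: left_diff_distrib[symmetric] abs_mult)
    qed
  next
    show "(\<lambda>N. f (N + N0) 0) \<longlonglongrightarrow> g 0"
      by (rule LIMSEQ_ignore_initial_segment[OF lim]) simp
  qed (use \<open>t \<ge> 0\<close> in auto)
  then obtain h where h: "\<And>x. x \<in> {0..t+1} \<Longrightarrow> (\<lambda>N. f (N + N0) x) \<longlonglongrightarrow> h x"
      "\<And>x. x \<in> {0..t+1} \<Longrightarrow> (h has_real_derivative g' x) (at x within {0..t+1})"
    unfolding has_field_derivative_def by metis
  have eq: "h x = g x" if "x \<in> {0..t+1}" for x
    using h(1)[OF that] LIMSEQ_ignore_initial_segment[OF lim[of x], of N0] that
    by (auto intro: LIMSEQ_unique)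
  have "(g has_real_derivative g' t) (at t within {0..t+1})"
    by (rule has_field_derivative_transform_within[OF h(2), of t 1]) (use eq \<open>t \<ge> 0\<close> in auto)
  then show ?thesis
    using at_within_atLeast_eq[of 0 t "t + 1"] \<open>t \<ge> 0\<close> by simp
qed

lemma has_real_derivative_integral_atLeast:
  fixes f :: "real \<Rightarrow> real"
  assumes "continuous_on {0..} f" "t \<ge> 0"
  shows "((\<lambda>t. integral {0..t} f) has_real_derivative f t) (at t within {0..})"
proof -
  have "((\<lambda>t. integral {0..t} f) has_real_derivative f t) (at t within {0..t+1})"
    by (rule integral_has_real_derivative)
      (use assms in \<open>auto intro: continuous_on_subset\<close>)
  then show ?thesis
    using at_within_atLeast_eq[of 0 t "t + 1"] assms by simp
qed

text \<open>A Cauchy criterion with a rate: the bound \<open>r i\<close> does not depend on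
  \<open>j\<close>, so it survives the limit in \<open>j\<close>.\<close>

lemma abs_diff_lim_le:
  fixes a :: "nat \<Rightarrow> real"
  assumes "\<And>i j. i0 \<le> i \<Longrightarrow> i \<le> j \<Longrightarrow> \<bar>a i - a j\<bar> \<le> r i"
    and "r \<longlonglongrightarrow> 0"
  shows "a \<longlonglongrightarrow> lim a" and "\<And>i. i0 \<le> i \<Longrightarrow> \<bar>a i - lim a\<bar> \<le> r i"
proof -
  have "Cauchy a"
  proof (rule CauchyI')
    fix e :: real assume "e > 0"
    obtain i1 where i1: "\<And>i. i \<ge> i1 \<Longrightarrow> \<bar>r i\<bar> < e"
      using LIMSEQ_D[OF assms(2) \<open>e > 0\<close>] by auto
    show "\<exists>i. \<forall>m\<ge>i. \<forall>n>m. dist (a m) (a n) < e"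
    proof (intro exI[of _ "max i0 i1"] allI impI)
      fix m n assume "max i0 i1 \<le> m" "m < n"
      then show "dist (a m) (a n) < e"
        using assms(1)[of m n] i1[of m] by (simp add: dist_real_def)
    qed
  qed
  then show lim: "a \<longlonglongrightarrow> lim a"
    by (simp add: Cauchy_convergent_iff convergent_LIMSEQ_iff)
  fix i assume "i0 \<le> i"
  show "\<bar>a i - lim a\<bar> \<le> r i"
  proof (rule LIMSEQ_le_const2)
    show "(\<lambda>j. \<bar>a i - a j\<bar>) \<longlonglongrightarrow> \<bar>a i - lim a\<bar>" by (intro tendsto_intros lim)
    show "\<exists>N. \<forall>j\<ge>N. \<bar>a i - a j\<bar> \<le> r i" using assms(1) \<open>i0 \<le> i\<close> by blast
  qed
qed

section \<open>Picard iteration for sequences\<close>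

text \<open>The field is bounded and Lipschitz in the supremum norm, uniformly in the component, so
  the iteration converges for all times. Unknowns indexed by all of \<open>nat\<close> let one
  statement serve Galerkin systems of every order.\<close>

lemma picard_lindelof_sequences:
  fixes F :: "nat \<Rightarrow> (nat \<Rightarrow> real) \<Rightarrow> real" and x :: "nat \<Rightarrow> real"
  assumes "L > 0"
    and lip: "\<And>n u v d. (\<And>m. \<bar>u m - v m\<bar> \<le> d) \<Longrightarrow> \<bar>F n u - F n v\<bar> \<le> L * d"
    and bound: "\<And>n u. \<bar>F n u\<bar> \<le> M"
    and cont: "\<And>n p. (\<And>m. continuous_on {0..} (p m)) \<Longrightarrow>
      continuous_on {0..} (\<lambda>t::real. F n (\<lambda>m. p m t))"
  shows "\<exists>X. \<forall>n. X n 0 = x n \<and>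
    (\<forall>t\<ge>0. (X n has_real_derivative F n (\<lambda>m. X m t)) (at t within {0..}))"
proof -
  define P :: "nat \<Rightarrow> nat \<Rightarrow> real \<Rightarrow> real" where "P = rec_nat (\<lambda>n t. x n) (\<lambda>_ p n t. x n + integral {0..t} (\<lambda>s. F n (\<lambda>m. p m s)))"
  have P0: "P 0 n t = x n" for n t by (simp add: P_def)
  have PSuc: "P (Suc j) n = (\<lambda>t. x n + integral {0..t} (\<lambda>s. F n (\<lambda>m. P j m s)))" for j n
    by (simp add: P_def)
  have der_step: "(P (Suc j) n has_real_derivative F n (\<lambda>m. P j m t)) (at t within {0..})"
    if "\<And>m. continuous_on {0..} (P j m)" "t \<ge> 0" for j n t
    unfolding PSuc
    using DERIV_add[OF DERIV_const has_real_derivative_integral_atLeast[OF cont[OF that(1)] that(2)]]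
    by simp
  have contP: "continuous_on {0..} (P j m)" for j m
  proof (induction j arbitrary: m)
    case 0
    have "P 0 m = (\<lambda>t. x m)" by (simp add: P0 fun_eq_iff)
    then show ?case by simp
  next
    case (Suc j)
    show ?case
      by (rule continuous_on_of_has_real_derivative[OF der_step]) (use Suc in auto)
  qed
  note der = der_step[OF contP]
  have init: "P j n 0 = x n" for j n
    by (cases j) (simp_all add: P0 PSuc)
  have "M \<ge> 0" using bound[of 0 x] by linarith
  \<comment> \<open>With this choice \<open>A * exp (2 * L * t)\<close> has derivative
    \<open>M * exp (2 * L * t)\<close>, which dominates the derivative of the first Picard
    increment.\<close>
  define A where "A = M / (2 * L)"
  have A: "A \<ge> 0" "2 * L * A = M" using \<open>M \<ge> 0\<close> \<open>L > 0\<close> by (auto simp: A_def)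
  have der_exp: "((\<lambda>t. c * exp (2 * L * t)) has_real_derivative c * (2 * L * exp (2 * L * t)))
      (at t within {0..})" for c t
    by (auto intro!: derivative_eq_intros)
  text \<open>With the weight \<open>exp (2 * L * t)\<close> each Picard step contracts by the factor \<open>1 / 2\<close>
    on the whole half line.\<close>
  have step_bound: "\<bar>P (Suc j) n t - P j n t\<bar> \<le> A / 2 ^ j * exp (2 * L * t)" if "t \<ge> 0" for j n t
    using that
  proof (induction j arbitrary: n t)
    case 0
    have "\<bar>P (Suc 0) n t - x n\<bar> \<le> A * exp (2 * L * t)"
    proof (rule abs_le_of_abs_deriv_le[OF DERIV_diff[OF der DERIV_const] der_exp])
      fix s :: real assume "s \<ge> 0"
      have "\<bar>F n (\<lambda>m. P 0 m s)\<bar> \<le> M * 1" using bound by simp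
      also have "\<dots> \<le> M * exp (2 * L * s)"
        using \<open>L > 0\<close> \<open>s \<ge> 0\<close> \<open>M \<ge> 0\<close> by (intro mult_left_mono) auto
      finally show "\<bar>F n (\<lambda>m. P 0 m s) - 0\<bar> \<le> A * (2 * L * exp (2 * L * s))"
        unfolding A(2)[symmetric] by (simp add: mult_ac)
    qed (use 0 A init in auto)
    then show ?case by (simp add: P0)
  next
    case (Suc j)
    show ?case
    proof (rule abs_le_of_abs_deriv_le[OF DERIV_diff[OF der der] der_exp])
      fix s :: real assume "s \<ge> 0"
      have "\<bar>F n (\<lambda>m. P (Suc j) m s) - F n (\<lambda>m. P j m s)\<bar> \<le> L * (A / 2 ^ j * exp (2 * L * s))"
        by (rule lip) (use Suc.IH \<open>s \<ge> 0\<close> in auto)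
      then show "\<bar>F n (\<lambda>m. P (Suc j) m s) - F n (\<lambda>m. P j m s)\<bar>
          \<le> A / 2 ^ Suc j * (2 * L * exp (2 * L * s))"
        by (simp add: mult_ac)
    qed (use Suc A init in auto)
  qed
  have tail: "\<bar>P i n t - P j n t\<bar> \<le> 2 * A * exp (2 * L * t) / 2 ^ i"
    if "i \<le> j" "t \<ge> 0" for i j n t
  proof -
    \<comment> \<open>The induction carries the exact geometric sum, since the bound with
      \<open>1 / 2 ^ i\<close> alone does not reproduce itself.\<close>
    have "\<bar>P i n t - P j n t\<bar> \<le> 2 * A * exp (2 * L * t) * (1 / 2 ^ i - 1 / 2 ^ j)"
      using \<open>i \<le> j\<close>
    proof (induction j rule: dec_induct)
      case (step j)
      have "\<bar>P i n t - P (Suc j) n t\<bar> \<le> \<bar>P i n t - P j n t\<bar> + \<bar>P (Suc j) n t - P j n t\<bar>"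
        by linarith
      also have "\<dots> \<le> 2 * A * exp (2 * L * t) * (1 / 2 ^ i - 1 / 2 ^ j) + A / 2 ^ j * exp (2 * L * t)"
        by (intro add_mono step.IH step_bound \<open>t \<ge> 0\<close>)
      also have "\<dots> = 2 * A * exp (2 * L * t) * (1 / 2 ^ i - 1 / 2 ^ Suc j)"
        by (simp add: algebra_simps)
      finally show ?case .
    qed simp
    also have "\<dots> \<le> 2 * A * exp (2 * L * t) * (1 / 2 ^ i)"
      using A by (intro mult_left_mono) auto
    finally show ?thesis by simp
  qed
  have null: "(\<lambda>i. c / 2 ^ i) \<longlonglongrightarrow> 0" for c :: real
    using tendsto_mult[OF tendsto_const[of c] LIMSEQ_realpow_zero[of "1/2"]]
    by (simp add: power_divide)
  define X where "X n t = lim (\<lambda>i. P i n t)" for n t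
  have lim: "(\<lambda>i. P i n t) \<longlonglongrightarrow> X n t" if "t \<ge> 0" for n t
    unfolding X_def by (rule abs_diff_lim_le(1)[OF tail null]) (use that in auto)
  have err: "\<bar>P i n t - X n t\<bar> \<le> 2 * A * exp (2 * L * t) / 2 ^ i" if "t \<ge> 0" for i n t
    unfolding X_def by (rule abs_diff_lim_le(2)[OF tail null, of 0]) (use that in auto)
  have "(X n has_real_derivative F n (\<lambda>m. X m t)) (at t within {0..})" if "t \<ge> 0" for n t
  \<comment> \<open>The derivative of iterate \<open>Suc j\<close> is the field at iterate
    \<open>j\<close>. By \<open>lip\<close> and \<open>err\<close> these fields converge uniformly
    on each \<open>{0..T}\<close>.\<close>
  proof (rule has_real_derivative_local_uniform_limit[where f = "\<lambda>j. P (Suc j) n"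
        and f' = "\<lambda>j t. F n (\<lambda>m. P j m t)" and g' = "\<lambda>t. F n (\<lambda>m. X m t)"])
    show "(\<lambda>j. P (Suc j) n s) \<longlonglongrightarrow> X n s" if "s \<ge> 0" for s
      using lim[OF that] by (rule LIMSEQ_Suc)
    fix T :: real assume "T \<ge> 0"
    show "uniform_limit {0..T} (\<lambda>j t. F n (\<lambda>m. P j m t)) (\<lambda>t. F n (\<lambda>m. X m t)) sequentially"
      unfolding uniform_limit_iff
    proof (intro allI impI)
      fix e :: real assume "e > 0"
      define c where "c = L * (2 * A * exp (2 * L * T))"
      have "\<forall>\<^sub>F j in sequentially. c / 2 ^ j < e"
        using order_tendstoD(2)[OF null \<open>e > 0\<close>] .
      then show "\<forall>\<^sub>F j in sequentially. \<forall>t\<in>{0..T}.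
          dist (F n (\<lambda>m. P j m t)) (F n (\<lambda>m. X m t)) < e"
      proof (rule eventually_mono, intro ballI)
        fix j t assume j: "c / 2 ^ j < e" and t: "t \<in> {0..T}"
        have "\<bar>P j m t - X m t\<bar> \<le> 2 * A * exp (2 * L * T) / 2 ^ j" for m
        proof -
          have "2 * A * exp (2 * L * t) / 2 ^ j \<le> 2 * A * exp (2 * L * T) / 2 ^ j"
            using t A \<open>L > 0\<close> by (intro divide_right_mono mult_left_mono) auto
          then show ?thesis using err[of t j m] t by auto
        qed
        then have "\<bar>F n (\<lambda>m. P j m t) - F n (\<lambda>m. X m t)\<bar> \<le> L * (2 * A * exp (2 * L * T) / 2 ^ j)"
          by (rule lip)
        with j show "dist (F n (\<lambda>m. P j m t)) (F n (\<lambda>m. X m t)) < e"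
          by (simp add: dist_real_def c_def)
      qed
    qed
  qed (use der that in \<open>auto intro: always_eventually\<close>)
  moreover have "X n 0 = x n" for n by (simp add: X_def init)
  ultimately show ?thesis by blast
qed

section \<open>Finitely many equations of the dyadic system\<close>

text \<open>The common ground of global solutions and Galerkin approximations. The equations are
  indexed from \<open>0\<close>, for the unknowns \<open>X 1\<close> to \<open>X N\<close>; the last
  of them also involves \<open>X (Suc N)\<close>, about which nothing is said.\<close>

definition dyadic_upto :: "(nat \<Rightarrow> real) \<Rightarrow> nat \<Rightarrow> (nat \<Rightarrow> real \<Rightarrow> real) \<Rightarrow> bool" where
  "dyadic_upto k N X \<longleftrightarrow> (\<forall>n<N. \<forall>t\<ge>0. (X (Suc n) has_real_derivative
     (k n * (X n t)\<^sup>2 - k (Suc n) * X (Suc n) t * X (Suc (Suc n)) t)) (at t within {0..}))"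

lemma dyadic_uptoD:
  assumes "dyadic_upto k N X" "n < N" "t \<ge> 0"
  shows "(X (Suc n) has_real_derivative
     (k n * (X n t)\<^sup>2 - k (Suc n) * X (Suc n) t * X (Suc (Suc n)) t)) (at t within {0..})"
  using assms by (simp add: dyadic_upto_def)

lemma dyadic_upto_mono: "dyadic_upto k N X \<Longrightarrow> M \<le> N \<Longrightarrow> dyadic_upto k M X"
  by (simp add: dyadic_upto_def)

text \<open>The sum telescopes: what leaves one level enters the next. Only the flux out of level
  \<open>N\<close> remains, and \<open>k 0 = 0\<close> closes the lower end.\<close>

lemma partial_energy_derivative:
  assumes "k 0 = 0" "dyadic_upto k N X" "t \<ge> 0"
  shows "((\<lambda>t. \<Sum>n<N. (X (Suc n) t)\<^sup>2) has_real_derivative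
    - 2 * k N * (X N t)\<^sup>2 * X (Suc N) t) (at t within {0..})"
  using assms(2)
proof (induction N)
  case 0
  then show ?case using assms by simp
next
  case (Suc N)
  have "((\<lambda>t. (\<Sum>n<N. (X (Suc n) t)\<^sup>2) + (X (Suc N) t)\<^sup>2) has_real_derivative
      - 2 * k N * (X N t)\<^sup>2 * X (Suc N) t + 2 * X (Suc N) t *
        (k N * (X N t)\<^sup>2 - k (Suc N) * X (Suc N) t * X (Suc (Suc N)) t)) (at t within {0..})"
    by (intro DERIV_add Suc.IH dyadic_upto_mono[OF Suc.prems])
      (auto intro!: derivative_eq_intros dyadic_uptoD[OF Suc.prems _ \<open>t \<ge> 0\<close>])
  then show ?case
    by (simp add: algebra_simps power2_eq_square)
qed

lemma partial_energy_antimono: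
  assumes "k 0 = 0" "dyadic_upto k N X" "k N \<ge> 0"
    and "\<And>t. t \<ge> 0 \<Longrightarrow> X (Suc N) t \<ge> 0"
    and "0 \<le> s" "s \<le> t"
  shows "(\<Sum>n<N. (X (Suc n) t)\<^sup>2) \<le> (\<Sum>n<N. (X (Suc n) s)\<^sup>2)"
proof -
  have "- (\<Sum>n<N. (X (Suc n) s)\<^sup>2) \<le> - (\<Sum>n<N. (X (Suc n) t)\<^sup>2)"
    by (rule nondecreasing_within_atLeast[OF DERIV_minus[OF partial_energy_derivative[OF assms(1,2)]]])
      (use assms in auto)
  then show ?thesis by simp
qed

text \<open>The weight halves from one level to the next, which cancels the factor \<open>2\<close> between the
  incoming and the outgoing coupling term of \<open>Z\<close>; of these only the one at level \<open>p\<close> survives.\<close>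

lemma weighted_difference_derivative:
  fixes X Y :: "nat \<Rightarrow> real \<Rightarrow> real"
  defines "Z \<equiv> \<lambda>n t. X n t - Y n t"
  assumes "k 0 = 0" "dyadic_upto k p X" "dyadic_upto k p Y" "t \<ge> 0"
  shows "((\<lambda>t. \<Sum>n<p. (Z (Suc n) t)\<^sup>2 / 2 ^ Suc n) has_real_derivative
    - (\<Sum>n<p. k (Suc n) / 2 ^ Suc n * (Z (Suc n) t)\<^sup>2 * (X (Suc (Suc n)) t + Y (Suc (Suc n)) t))
    - k p / 2 ^ p * ((X p t)\<^sup>2 - (Y p t)\<^sup>2) * Z (Suc p) t) (at t within {0..})"
  using assms(3,4)
proof (induction p)
  case 0
  then show ?case using assms by simp
next
  case (Suc p)
  let ?S = "\<Sum>n<p. k (Suc n) / 2 ^ Suc n * (Z (Suc n) t)\<^sup>2 * (X (Suc (Suc n)) t + Y (Suc (Suc n)) t)"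
  let ?d = "(k p * (X p t)\<^sup>2 - k (Suc p) * X (Suc p) t * X (Suc (Suc p)) t)
    - (k p * (Y p t)\<^sup>2 - k (Suc p) * Y (Suc p) t * Y (Suc (Suc p)) t)"
  have Z: "(Z (Suc p) has_real_derivative ?d) (at t within {0..})"
    unfolding Z_def
    by (intro DERIV_diff dyadic_uptoD[OF Suc.prems(1)] dyadic_uptoD[OF Suc.prems(2)])
      (use \<open>t \<ge> 0\<close> in auto)
  have "((\<lambda>t. (\<Sum>n<p. (Z (Suc n) t)\<^sup>2 / 2 ^ Suc n) + (Z (Suc p) t)\<^sup>2 / 2 ^ Suc p)
      has_real_derivative
      (- ?S - k p / 2 ^ p * ((X p t)\<^sup>2 - (Y p t)\<^sup>2) * Z (Suc p) t)
      + 2 * Z (Suc p) t * ?d / 2 ^ Suc p) (at t within {0..})"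
    by (intro DERIV_add Suc.IH dyadic_upto_mono[OF Suc.prems(1)] dyadic_upto_mono[OF Suc.prems(2)])
      (auto intro!: derivative_eq_intros Z)
  then show ?case
    unfolding sum.lessThan_Suc
  proof (rule DERIV_cong)
    \<comment> \<open>The incoming term cancels the old term at level \<open>p\<close>. The outgoing
      one is split by \<open>2 * (a * b - c * d) = (a - c) * (b + d) + (a + c) * (b - d)\<close>
      into the new summand of \<open>?S\<close> and the new term at level
      \<open>Suc p\<close>.\<close>
    show "(- ?S - k p / 2 ^ p * ((X p t)\<^sup>2 - (Y p t)\<^sup>2) * Z (Suc p) t)
      + 2 * Z (Suc p) t * ?d / 2 ^ Suc p =
    - (?S + k (Suc p) / 2 ^ Suc p * (Z (Suc p) t)\<^sup>2 * (X (Suc (Suc p)) t + Y (Suc (Suc p)) t))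
    - k (Suc p) / 2 ^ Suc p * ((X (Suc p) t)\<^sup>2 - (Y (Suc p) t)\<^sup>2) * Z (Suc (Suc p)) t"
      by (simp add: Z_def field_simps power2_eq_square)
  qed
qed

text \<open>Comparing two families through their first \<open>N\<close> equations covers both two
  solutions and two Galerkin approximations of different orders. The pointwise bounds extend to
  level \<open>Suc N\<close>, which the last coupling term involves.\<close>

lemma weighted_difference_bound:
  fixes X Y :: "nat \<Rightarrow> real \<Rightarrow> real"
  assumes "k 0 = 0" and k: "\<And>n. n \<ge> 1 \<Longrightarrow> 0 \<le> k n \<and> k n \<le> C * 2 ^ n"
    and X: "dyadic_upto k N X" and Y: "dyadic_upto k N Y"
    and init: "\<And>n. n < N \<Longrightarrow> X (Suc n) 0 = Y (Suc n) 0"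
    and Xb: "\<And>n t. n \<le> N \<Longrightarrow> t \<ge> 0 \<Longrightarrow> 0 \<le> X (Suc n) t \<and> X (Suc n) t \<le> B"
    and Yb: "\<And>n t. n \<le> N \<Longrightarrow> t \<ge> 0 \<Longrightarrow> 0 \<le> Y (Suc n) t \<and> Y (Suc n) t \<le> B"
    and XE: "\<And>t. t \<ge> 0 \<Longrightarrow> (\<Sum>n<N. (X (Suc n) t)\<^sup>2) \<le> B\<^sup>2"
    and YE: "\<And>t. t \<ge> 0 \<Longrightarrow> (\<Sum>n<N. (Y (Suc n) t)\<^sup>2) \<le> B\<^sup>2"
    and "n < N" "t \<ge> 0"
  shows "real (N - n) * (X (Suc n) t - Y (Suc n) t)\<^sup>2 \<le> 2 ^ Suc n * (2 * C * B ^ 3 * t)"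
proof -
  define psi where "psi p t = (\<Sum>n<p. (X (Suc n) t - Y (Suc n) t)\<^sup>2 / 2 ^ Suc n)" for p t
  define psi' where "psi' p t =
    - (\<Sum>n<p. k (Suc n) / 2 ^ Suc n * (X (Suc n) t - Y (Suc n) t)\<^sup>2
        * (X (Suc (Suc n)) t + Y (Suc (Suc n)) t))
    - k p / 2 ^ p * ((X p t)\<^sup>2 - (Y p t)\<^sup>2) * (X (Suc p) t - Y (Suc p) t)" for p t
  have der: "(psi p has_real_derivative psi' p t) (at t within {0..})" if "p \<le> N" "t \<ge> 0" for p t
    unfolding psi_def[abs_def] psi'_def
    by (rule weighted_difference_derivative)
      (use assms that dyadic_upto_mono[OF X] dyadic_upto_mono[OF Y] in auto)
  have "C \<ge> 0" using k[of 1] by simp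
  have "B \<ge> 0" using Xb[of 0 0] by linarith
  have psi'_le: "psi' (Suc p) t \<le> C * B * ((X (Suc p) t)\<^sup>2 + (Y (Suc p) t)\<^sup>2)"
    if "p < N" "t \<ge> 0" for p t
  proof -
    have 1: "0 \<le> (\<Sum>n<Suc p. k (Suc n) / 2 ^ Suc n * (X (Suc n) t - Y (Suc n) t)\<^sup>2
        * (X (Suc (Suc n)) t + Y (Suc (Suc n)) t))"
      using that k Xb Yb
      by (intro sum_nonneg mult_nonneg_nonneg divide_nonneg_nonneg add_nonneg_nonneg) auto
    have "- (k (Suc p) / 2 ^ Suc p * ((X (Suc p) t)\<^sup>2 - (Y (Suc p) t)\<^sup>2)
        * (X (Suc (Suc p)) t - Y (Suc (Suc p)) t))
      \<le> \<bar>k (Suc p) / 2 ^ Suc p\<bar> * \<bar>(X (Suc p) t)\<^sup>2 - (Y (Suc p) t)\<^sup>2\<bar>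
        * \<bar>X (Suc (Suc p)) t - Y (Suc (Suc p)) t\<bar>"
      unfolding abs_mult[symmetric] by (rule abs_ge_minus_self)
    also have "\<dots> \<le> C * ((X (Suc p) t)\<^sup>2 + (Y (Suc p) t)\<^sup>2) * B"
    proof (intro mult_mono)
      show "\<bar>k (Suc p) / 2 ^ Suc p\<bar> \<le> C"
        using k[of "Suc p"] by (simp add: divide_le_eq)
      \<comment> \<open>Both values lie between \<open>0\<close> and \<open>B\<close>, so their
        difference is at most \<open>B\<close> and not just \<open>2 * B\<close>.\<close>
      show "\<bar>X (Suc (Suc p)) t - Y (Suc (Suc p)) t\<bar> \<le> B"
        using Xb[of "Suc p" t] Yb[of "Suc p" t] that by auto
    qed (use \<open>C \<ge> 0\<close> in \<open>auto simp: abs_le_iff\<close>)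
    finally show ?thesis using 1 by (simp add: psi'_def mult_ac)
  qed
  have "(\<Sum>p<N. psi (Suc p) t) \<le> 2 * C * B ^ 3 * t"
  proof (rule le_of_deriv_le[where f = "\<lambda>t. \<Sum>p<N. psi (Suc p) t" and g = "\<lambda>t. 2 * C * B ^ 3 * t"
        and f' = "\<lambda>t. \<Sum>p<N. psi' (Suc p) t" and g' = "\<lambda>t. 2 * C * B ^ 3"])
    fix s :: real assume s: "s \<ge> 0"
    show "((\<lambda>t. \<Sum>p<N. psi (Suc p) t) has_real_derivative (\<Sum>p<N. psi' (Suc p) s)) (at s within {0..})"
      by (intro DERIV_sum der) (use s in auto)
    show "((\<lambda>t. 2 * C * B ^ 3 * t) has_real_derivative 2 * C * B ^ 3) (at s within {0..})"
      by (auto intro!: derivative_eq_intros)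
    have "(\<Sum>p<N. psi' (Suc p) s) \<le> (\<Sum>p<N. C * B * ((X (Suc p) s)\<^sup>2 + (Y (Suc p) s)\<^sup>2))"
      by (intro sum_mono psi'_le) (use s in auto)
    also have "\<dots> = C * B * ((\<Sum>p<N. (X (Suc p) s)\<^sup>2) + (\<Sum>p<N. (Y (Suc p) s)\<^sup>2))"
      by (simp add: sum_distrib_left sum.distrib[symmetric])
    also have "\<dots> \<le> C * B * (B\<^sup>2 + B\<^sup>2)"
      using XE[OF s] YE[OF s] \<open>C \<ge> 0\<close> \<open>B \<ge> 0\<close> by (intro mult_left_mono add_mono) auto
    also have "\<dots> = 2 * C * B ^ 3"
      by (simp add: power2_eq_square power3_eq_cube)
    finally show "(\<Sum>p<N. psi' (Suc p) s) \<le> 2 * C * B ^ 3" .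
  qed (use init \<open>t \<ge> 0\<close> in \<open>auto simp: psi_def\<close>)
  \<comment> \<open>The square at level \<open>Suc n\<close> occurs in \<open>psi (Suc p)\<close>
    for every \<open>p\<close> in \<open>{n..<N}\<close>, which produces the factor
    \<open>N - n\<close>.\<close>
  moreover have "real (N - n) * ((X (Suc n) t - Y (Suc n) t)\<^sup>2 / 2 ^ Suc n) \<le> (\<Sum>p<N. psi (Suc p) t)"
  proof -
    have "real (N - n) * ((X (Suc n) t - Y (Suc n) t)\<^sup>2 / 2 ^ Suc n)
        = (\<Sum>p\<in>{n..<N}. (X (Suc n) t - Y (Suc n) t)\<^sup>2 / 2 ^ Suc n)"
      by simp
    also have "\<dots> \<le> (\<Sum>p\<in>{n..<N}. psi (Suc p) t)"
      unfolding psi_def by (intro sum_mono member_le_sum) auto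
    also have "\<dots> \<le> (\<Sum>p<N. psi (Suc p) t)"
      by (rule sum_mono2) (auto simp: psi_def intro!: sum_nonneg add_nonneg_nonneg)
    finally show ?thesis .
  qed
  ultimately have "real (N - n) * ((X (Suc n) t - Y (Suc n) t)\<^sup>2 / 2 ^ Suc n) \<le> 2 * C * B ^ 3 * t"
    by linarith
  then show ?thesis by (simp add: field_simps)
qed

section \<open>Global solutions\<close>

lemma partial_sum_square_le_ell2_norm:
  assumes "x \<in> ell2"
  shows "(\<Sum>n<N. (x (Suc n))\<^sup>2) \<le> (ell2_norm x)\<^sup>2"
proof -
  have sm: "summable (\<lambda>n. (x (Suc n))\<^sup>2)" using assms by (simp add: ell2_def)
  then have "(ell2_norm x)\<^sup>2 = (\<Sum>n. (x (Suc n))\<^sup>2)"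
    by (simp add: ell2_norm_def suminf_nonneg)
  then show ?thesis
    using sum_le_suminf[OF sm, of "{..<N}"] by simp
qed

lemma ell2_norm_leI:
  assumes "\<And>N. (\<Sum>n<N. (x (Suc n))\<^sup>2) \<le> b\<^sup>2" "b \<ge> 0"
  shows "x \<in> ell2" "ell2_norm x \<le> b"
proof -
  have sm: "summable (\<lambda>n. (x (Suc n))\<^sup>2)"
    by (rule bounded_imp_summable[of _ "b\<^sup>2"])
      (use assms(1)[of "Suc _"] in \<open>auto simp: lessThan_Suc_atMost\<close>)
  then show "x \<in> ell2" by (simp add: ell2_def)
  show "ell2_norm x \<le> b"
    unfolding ell2_norm_def
    by (rule real_le_lsqrt) (use suminf_le_const[OF sm assms(1)] assms(2) in auto)
qed

lemma ell2_norm_nonneg: "x \<in> ell2 \<Longrightarrow> ell2_norm x \<ge> 0"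
  by (simp add: ell2_norm_def ell2_def suminf_nonneg)

lemma time_interval_infinity: "time_interval \<infinity> = {0..}"
  by (auto simp: time_interval_def)

section \<open>Positivity and energy of solutions\<close>

text \<open>The incoming term is nonnegative, so \<open>X (Suc n)\<close> satisfies a linear
  differential inequality whose coefficient is continuous and hence bounded on
  \<open>{0..t}\<close>. Each level can be treated on its own, whatever the signs of its
  neighbours.\<close>

lemma dyadic_upto_nonneg:
  assumes k: "\<And>n. n \<ge> 1 \<Longrightarrow> k n \<ge> 0" and "k 0 = 0"
    and X: "dyadic_upto k N X"
    and "n < N" "continuous_on {0..} (X (Suc (Suc n)))" "X (Suc n) 0 \<ge> 0" "t \<ge> 0"
  shows "X (Suc n) t \<ge> 0"
proof -
  have k': "k m \<ge> 0" for m using k[of m] \<open>k 0 = 0\<close> by (cases m) auto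
  have "compact ((\<lambda>s. k (Suc n) * X (Suc (Suc n)) s) ` {0..t})"
    by (intro compact_continuous_image continuous_intros continuous_on_subset[OF assms(5)]) auto
  then obtain B where "\<forall>y\<in>(\<lambda>s. k (Suc n) * X (Suc (Suc n)) s) ` {0..t}. norm y \<le> B"
    using compact_imp_bounded bounded_iff by blast
  then have B: "\<bar>k (Suc n) * X (Suc (Suc n)) s\<bar> \<le> B" if "s \<in> {0..t}" for s
    using that by auto
  show ?thesis
  proof (rule nonneg_of_deriv_ge[OF dyadic_uptoD[OF X \<open>n < N\<close>] _ assms(6,7)])
    fix s assume s: "0 \<le> s" "s \<le> t" "X (Suc n) s < 0"
    have "k (Suc n) * X (Suc (Suc n)) s * X (Suc n) s \<le> - B * X (Suc n) s"
      using B[of s] s by (intro mult_right_mono_neg) auto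
    moreover have "0 \<le> k n * (X n s)\<^sup>2" using k' by simp
    ultimately show "B * X (Suc n) s
        \<le> k n * (X n s)\<^sup>2 - k (Suc n) * X (Suc n) s * X (Suc (Suc n)) s"
      by (simp add: mult_ac)
  qed
qed

lemma global_solution_dyadic_upto: "global_solution k x X \<Longrightarrow> dyadic_upto k N X"
  unfolding dyadic_upto_def
proof (intro allI impI)
  fix n and t :: real assume "global_solution k x X" "t \<ge> 0"
  then have "\<forall>n\<ge>1. \<forall>t\<in>{0..}. (X n has_real_derivative
      k (n - 1) * (X (n - 1) t)\<^sup>2 - k n * X n t * X (n + 1) t) (at t within {0..})"
    unfolding dyadic_solution_def time_interval_infinity by blast
  from this[rule_format, of "Suc n" t] \<open>t \<ge> 0\<close>
  show "(X (Suc n) has_real_derivative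
      k n * (X n t)\<^sup>2 - k (Suc n) * X (Suc n) t * X (Suc (Suc n)) t) (at t within {0..})"
    by simp
qed

lemma global_solution_nonneg:
  assumes "k 0 = 0" "\<And>n. n \<ge> 1 \<Longrightarrow> k n \<ge> 0"
    and X: "global_solution k x X" and "\<And>n. n \<ge> 1 \<Longrightarrow> x n \<ge> 0" and "t \<ge> 0"
  shows "X n t \<ge> 0"
proof (cases n)
  case 0
  then show ?thesis using X \<open>t \<ge> 0\<close> by (simp add: dyadic_solution_def time_interval_infinity)
next
  case (Suc m)
  note D = global_solution_dyadic_upto[OF X]
  have "continuous_on {0..} (X (Suc (Suc m)))"
    by (rule continuous_on_of_has_real_derivative[OF dyadic_uptoD[OF D, of _ "Suc (Suc m)"]]) auto
  moreover have "X (Suc m) 0 \<ge> 0" using X assms(4) by (simp add: dyadic_solution_def)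
  ultimately show ?thesis
    using dyadic_upto_nonneg[OF assms(2,1) D, of m "Suc m"] Suc \<open>t \<ge> 0\<close> by simp
qed

text \<open>By positivity the partial energies of every order are nonincreasing, and the norm is the
  supremum of their square roots.\<close>

lemma global_solution_leray_hopf:
  assumes "k 0 = 0" and k: "\<And>n. n \<ge> 1 \<Longrightarrow> k n \<ge> 0"
    and X: "global_solution k x X" and x: "\<And>n. n \<ge> 1 \<Longrightarrow> x n \<ge> 0"
  shows "leray_hopf_solution k \<infinity> x X"
  unfolding leray_hopf_solution_def
proof (intro conjI ballI impI X)
  fix s t assume *: "s \<in> time_interval \<infinity>" "t \<in> time_interval \<infinity>" "s < t"
  then have st: "0 \<le> s" "s \<le> t" by (auto simp: time_interval_infinity)
  have k': "k m \<ge> 0" for m using k[of m] \<open>k 0 = 0\<close> by (cases m) auto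
  have ell2: "(\<lambda>n. X n s) \<in> ell2" using X * by (simp add: dyadic_solution_def)
  show "ell2_norm (\<lambda>n. X n s) \<ge> ell2_norm (\<lambda>n. X n t)"
  proof (rule ell2_norm_leI(2))
    fix N
    have "(\<Sum>n<N. (X (Suc n) t)\<^sup>2) \<le> (\<Sum>n<N. (X (Suc n) s)\<^sup>2)"
      by (rule partial_energy_antimono[OF assms(1) global_solution_dyadic_upto[OF X] k' _ st])
        (rule global_solution_nonneg[OF assms])
    also have "\<dots> \<le> (ell2_norm (\<lambda>n. X n s))\<^sup>2"
      by (rule partial_sum_square_le_ell2_norm[OF ell2])
    finally show "(\<Sum>n<N. (X (Suc n) t)\<^sup>2) \<le> (ell2_norm (\<lambda>n. X n s))\<^sup>2" .
  qed (rule ell2_norm_nonneg[OF ell2])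
qed

section \<open>Uniqueness for positive initial data\<close>

lemma le_of_partial_sum_square_le:
  fixes a :: "nat \<Rightarrow> real"
  assumes "(\<Sum>n<N. (a n)\<^sup>2) \<le> B\<^sup>2" "n < N" "B \<ge> 0"
  shows "a n \<le> B"
proof -
  have "(a n)\<^sup>2 \<le> (\<Sum>n<N. (a n)\<^sup>2)" using assms(2) by (intro member_le_sum) auto
  then have "(a n)\<^sup>2 \<le> B\<^sup>2" using assms(1) by linarith
  then show ?thesis using assms(3) by (rule power2_le_imp_le)
qed

lemma global_solution_partial_energy_le:
  assumes "k 0 = 0" and k: "\<And>n. n \<ge> 1 \<Longrightarrow> k n \<ge> 0"
    and X: "global_solution k x X" and "x \<in> ell2" and x: "\<And>n. n \<ge> 1 \<Longrightarrow> x n \<ge> 0" and "t \<ge> 0"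
  shows "(\<Sum>n<N. (X (Suc n) t)\<^sup>2) \<le> (ell2_norm x)\<^sup>2"
proof -
  have k': "k m \<ge> 0" for m using k[of m] \<open>k 0 = 0\<close> by (cases m) auto
  have "(\<Sum>n<N. (X (Suc n) t)\<^sup>2) \<le> (\<Sum>n<N. (X (Suc n) 0)\<^sup>2)"
    by (rule partial_energy_antimono[OF assms(1) global_solution_dyadic_upto[OF X] k'])
      (use global_solution_nonneg[OF assms(1-3) x] \<open>t \<ge> 0\<close> in auto)
  also have "\<dots> = (\<Sum>n<N. (x (Suc n))\<^sup>2)"
    using X by (simp add: dyadic_solution_def)
  also have "\<dots> \<le> (ell2_norm x)\<^sup>2"
    by (rule partial_sum_square_le_ell2_norm[OF assms(4)])
  finally show ?thesis .
qed

lemma global_solution_unique: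
  assumes "k 0 = 0" and k: "\<And>n. n \<ge> 1 \<Longrightarrow> 0 \<le> k n \<and> k n \<le> C * 2 ^ n"
    and "x \<in> ell2" and x: "\<And>n. n \<ge> 1 \<Longrightarrow> x n \<ge> 0"
    and X: "global_solution k x X" and Y: "global_solution k x Y" and "n \<ge> 1" "t \<ge> 0"
  shows "Y n t = X n t"
proof -
  have k0: "\<And>n. n \<ge> 1 \<Longrightarrow> k n \<ge> 0" using k by blast
  obtain m where n: "n = Suc m" using \<open>n \<ge> 1\<close> by (cases n) auto
  define B where "B = ell2_norm x"
  have E: "(\<Sum>n<N. (V (Suc n) t)\<^sup>2) \<le> B\<^sup>2"
    if "global_solution k x V" "t \<ge> 0" for V N t
    unfolding B_def
    by (rule global_solution_partial_energy_le[OF \<open>k 0 = 0\<close> k0 that(1) \<open>x \<in> ell2\<close> x that(2)])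
  have b: "0 \<le> V (Suc n) t \<and> V (Suc n) t \<le> B"
    if "global_solution k x V" "t \<ge> 0" for V n t
    using global_solution_nonneg[OF \<open>k 0 = 0\<close> k0 that(1) x that(2)]
      le_of_partial_sum_square_le[OF E[OF that, of "Suc n"] lessI] ell2_norm_nonneg[OF \<open>x \<in> ell2\<close>]
    by (simp add: B_def)
  define d where "d = (X n t - Y n t)\<^sup>2"
  define c where "c = 2 ^ n * (2 * C * B ^ 3 * t)"
  have init: "V (Suc n) 0 = x (Suc n)" if "global_solution k x V" for V n
    using that by (simp add: dyadic_solution_def)
  have bound: "real (N - m) * d \<le> c" if "m < N" for N
    unfolding d_def c_def n
    by (rule weighted_difference_bound[OF \<open>k 0 = 0\<close> k global_solution_dyadic_upto[OF X]
          global_solution_dyadic_upto[OF Y] _ b[OF X] b[OF Y] E[OF X] E[OF Y] that \<open>t \<ge> 0\<close>])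
      (simp_all add: init[OF X] init[OF Y])
  have "d = 0"
  proof (rule ccontr)
    assume "d \<noteq> 0"
    then have "d > 0" by (simp add: d_def)
    \<comment> \<open>In \<open>bound\<close> the order \<open>m + Suc N\<close> is used: it exceeds
      \<open>m\<close> and turns the factor into \<open>Suc N\<close>.\<close>
    then obtain N where N: "c < real N * d" using reals_Archimedean3 by blast
    have "real N * d \<le> real (Suc N) * d" using \<open>d > 0\<close> by simp
    also have "\<dots> \<le> c" using bound[of "m + Suc N"] by simp
    finally show False using N by simp
  qed
  then show ?thesis by (simp add: d_def)
qed

section \<open>Galerkin approximations\<close>

text \<open>For \<open>R >= 0\<close> the projection onto \<open>{0..R}\<close>. It makes the
  quadratic field bounded and globally Lipschitz, as the Picard iteration requires. The lower cut
  yields nonnegative solutions; the upper one will turn out to be inactive.\<close>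

definition cutoff :: "real \<Rightarrow> real \<Rightarrow> real" where
  "cutoff R u = max 0 (min R u)"

lemma cutoff_bounds: "R \<ge> 0 \<Longrightarrow> 0 \<le> cutoff R u \<and> cutoff R u \<le> R"
  by (auto simp: cutoff_def)

lemma cutoff_lipschitz: "\<bar>cutoff R u - cutoff R v\<bar> \<le> \<bar>u - v\<bar>"
  by (auto simp: cutoff_def)

lemma cutoff_mult_lipschitz:
  assumes "R \<ge> 0" "\<bar>a - a'\<bar> \<le> d" "\<bar>b - b'\<bar> \<le> d"
  shows "\<bar>cutoff R a * cutoff R b - cutoff R a' * cutoff R b'\<bar> \<le> 2 * R * d"
proof -
  have "\<bar>cutoff R a * cutoff R b - cutoff R a' * cutoff R b'\<bar>
      = \<bar>cutoff R a * (cutoff R b - cutoff R b') + (cutoff R a - cutoff R a') * cutoff R b'\<bar>"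
    by (simp add: algebra_simps)
  also have "\<dots> \<le> \<bar>cutoff R a\<bar> * \<bar>cutoff R b - cutoff R b'\<bar> + \<bar>cutoff R a - cutoff R a'\<bar> * \<bar>cutoff R b'\<bar>"
    unfolding abs_mult[symmetric] by (rule abs_triangle_ineq)
  also have "\<dots> \<le> R * d + d * R"
    using cutoff_bounds[OF \<open>R \<ge> 0\<close>] cutoff_lipschitz assms
    by (intro add_mono mult_mono) (auto intro: order_trans[OF cutoff_lipschitz])
  finally show ?thesis by simp
qed

text \<open>Components with index \<open>0\<close> or above \<open>N\<close> are frozen. Started at
  \<open>0\<close> they stay \<open>0\<close>, which closes the system at level
  \<open>Suc N\<close>.\<close>

definition cutoff_field :: "(nat \<Rightarrow> real) \<Rightarrow> nat \<Rightarrow> real \<Rightarrow> nat \<Rightarrow> (nat \<Rightarrow> real) \<Rightarrow> real" where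
  "cutoff_field k N R n u = (if 1 \<le> n \<and> n \<le> N
     then k (n - 1) * (cutoff R (u (n - 1)))\<^sup>2 - k n * (cutoff R (u n) * cutoff R (u (Suc n)))
     else 0)"

lemma cutoff_solution_exists:
  assumes K: "\<And>n. n \<le> N \<Longrightarrow> 0 \<le> k n \<and> k n \<le> K" and "R \<ge> 0"
  shows "\<exists>X. \<forall>n. X n 0 = x n \<and>
    (\<forall>t\<ge>0. (X n has_real_derivative cutoff_field k N R n (\<lambda>m. X m t)) (at t within {0..}))"
\<comment> \<open>Each of the two products has Lipschitz constant \<open>2 * R\<close> and a
  coefficient at most \<open>K\<close>; the \<open>+ 1\<close> keeps \<open>L\<close> positive even
  if \<open>K * R = 0\<close>.\<close>
proof (rule picard_lindelof_sequences[where L = "4 * K * R + 1" and M = "2 * K * R\<^sup>2"])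
  have "K \<ge> 0" using K[of 0] by simp
  then show "4 * K * R + 1 > 0" using \<open>R \<ge> 0\<close> by (intro add_nonneg_pos) auto
  note bounds = cutoff_bounds[OF \<open>R \<ge> 0\<close>]
  fix n
  show "\<bar>cutoff_field k N R n u - cutoff_field k N R n v\<bar> \<le> (4 * K * R + 1) * d"
    if d: "\<And>m. \<bar>u m - v m\<bar> \<le> d" for u v :: "nat \<Rightarrow> real" and d
  proof (cases "1 \<le> n \<and> n \<le> N")
    case True
    have "d \<ge> 0" using d[of 0] by linarith
    have lip: "\<bar>cutoff R (u i) * cutoff R (u j) - cutoff R (v i) * cutoff R (v j)\<bar> \<le> 2 * R * d" for i j
      by (rule cutoff_mult_lipschitz[OF \<open>R \<ge> 0\<close> d d])
    have term_le: "\<bar>k l * (cutoff R (u i) * cutoff R (u j) - cutoff R (v i) * cutoff R (v j))\<bar>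
        \<le> K * (2 * R * d)" if "l \<le> N" for l i j
      unfolding abs_mult using K[OF that] \<open>K \<ge> 0\<close> by (intro mult_mono lip) auto
    have "cutoff_field k N R n u - cutoff_field k N R n v
        = k (n - 1) * (cutoff R (u (n - 1)) * cutoff R (u (n - 1)) - cutoff R (v (n - 1)) * cutoff R (v (n - 1)))
        - k n * (cutoff R (u n) * cutoff R (u (Suc n)) - cutoff R (v n) * cutoff R (v (Suc n)))"
      using True by (simp add: cutoff_field_def power2_eq_square right_diff_distrib)
    then have "\<bar>cutoff_field k N R n u - cutoff_field k N R n v\<bar>
        \<le> \<bar>k (n - 1) * (cutoff R (u (n - 1)) * cutoff R (u (n - 1)) - cutoff R (v (n - 1)) * cutoff R (v (n - 1)))\<bar>
        + \<bar>k n * (cutoff R (u n) * cutoff R (u (Suc n)) - cutoff R (v n) * cutoff R (v (Suc n)))\<bar>"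
      by (metis abs_triangle_ineq4)
    also have "\<dots> \<le> K * (2 * R * d) + K * (2 * R * d)"
      by (intro add_mono term_le) (use True in auto)
    also have "\<dots> \<le> (4 * K * R + 1) * d" using \<open>d \<ge> 0\<close> by (simp add: algebra_simps)
    finally show ?thesis .
  next
    case False
    then have "cutoff_field k N R n w = 0" for w by (auto simp: cutoff_field_def)
    moreover have "d \<ge> 0" using d[of 0] by linarith
    ultimately show ?thesis using \<open>K \<ge> 0\<close> \<open>R \<ge> 0\<close> by simp
  qed
  show "\<bar>cutoff_field k N R n u\<bar> \<le> 2 * K * R\<^sup>2" for u
  proof (cases "1 \<le> n \<and> n \<le> N")
    case True
    have term_le: "0 \<le> k l * (cutoff R (u i) * cutoff R (u j))"
        "k l * (cutoff R (u i) * cutoff R (u j)) \<le> K * (R * R)" if "l \<le> N" for l i j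
      using K[OF that] \<open>K \<ge> 0\<close> \<open>R \<ge> 0\<close> bounds
      by (auto intro!: mult_nonneg_nonneg mult_mono)
    have "n - 1 \<le> N" "n \<le> N" using True by auto
    then have "\<bar>cutoff_field k N R n u\<bar> \<le> K * (R * R)"
      using term_le[of "n - 1" "n - 1" "n - 1"] term_le[of n n "Suc n"] True
      by (simp add: cutoff_field_def power2_eq_square abs_le_iff)
    also have "\<dots> \<le> 2 * K * R\<^sup>2" using \<open>K \<ge> 0\<close> by (simp add: power2_eq_square)
    finally show ?thesis .
  next
    case False
    then have "cutoff_field k N R n u = 0" by (auto simp: cutoff_field_def)
    then show ?thesis using \<open>K \<ge> 0\<close> by simp
  qed
  show "continuous_on {0..} (\<lambda>t::real. cutoff_field k N R n (\<lambda>m. p m t))"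
    if "\<And>m. continuous_on {0..} (p m)" for p
    by (cases "1 \<le> n \<and> n \<le> N")
      (auto simp: cutoff_field_def cutoff_def intro!: continuous_intros that)
qed

text \<open>Where a component is negative its outgoing term is cut off, so the derivative is
  nonnegative there and the sign criterion applies with constant \<open>0\<close>.\<close>

lemma nonneg_of_cutoff_solution:
  assumes "\<And>n. n \<le> N \<Longrightarrow> 0 \<le> k n"
    and "\<And>n t. t \<ge> 0 \<Longrightarrow>
      (X n has_real_derivative cutoff_field k N R n (\<lambda>m. X m t)) (at t within {0..})"
    and "X n 0 \<ge> 0" "t \<ge> 0"
  shows "X n t \<ge> 0"
proof (rule nonneg_of_deriv_ge[OF assms(2) _ assms(3,4)])
  fix s assume "X n s < 0"
  then have "cutoff R (X n s) = 0" by (simp add: cutoff_def)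
  then show "0 * X n s \<le> cutoff_field k N R n (\<lambda>m. X m s)"
    using assms(1)[of "n - 1"] by (auto simp: cutoff_field_def)
qed

text \<open>The energy \<open>u\<^sup>2\<close> is replaced by a primitive of \<open>2 * cutoff R u\<close>, because with this choice
  the cut-off system has the same cancellations as the dyadic one.\<close>

definition cutoff_energy :: "real \<Rightarrow> real \<Rightarrow> real" where
  "cutoff_energy R u = (max 0 u)\<^sup>2 - (max 0 (u - R))\<^sup>2"

lemma cutoff_energy_le: "cutoff_energy R u \<le> u\<^sup>2"
proof -
  have "(max 0 u)\<^sup>2 \<le> u\<^sup>2" by (simp add: max_def)
  moreover have "(max 0 (u - R))\<^sup>2 \<ge> 0" by simp
  ultimately show ?thesis unfolding cutoff_energy_def by linarith
qed

lemma cutoff_energy_nonneg: "R \<ge> 0 \<Longrightarrow> cutoff_energy R u \<ge> 0"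
  unfolding cutoff_energy_def by (simp add: power_mono)

lemma has_real_derivative_cutoff_energy:
  assumes "R \<ge> 0" "(f has_real_derivative d) (at t within S)"
  shows "((\<lambda>t. cutoff_energy R (f t)) has_real_derivative 2 * cutoff R (f t) * d) (at t within S)"
proof -
  have "((\<lambda>t. (max 0 (f t))\<^sup>2 - (max 0 (f t - R))\<^sup>2) has_real_derivative
      2 * max 0 (f t) * d - 2 * max 0 (f t - R) * (d - 0)) (at t within S)"
    by (intro DERIV_diff DERIV_chain2[OF has_real_derivative_pos_part_square] DERIV_const assms(2))
  moreover have "2 * max 0 (f t) * d - 2 * max 0 (f t - R) * (d - 0) = 2 * cutoff R (f t) * d"
    using \<open>R \<ge> 0\<close> by (auto simp: cutoff_def max_def min_def algebra_simps)
  ultimately show ?thesis by (simp add: cutoff_energy_def)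
qed

text \<open>Up to level \<open>N\<close> the field is the dyadic one at the cut-off values, and
  differentiating the energy multiplies it by twice the cut-off value. The telescoping is therefore
  that of \<open>partial_energy_derivative\<close>.\<close>

lemma cutoff_energy_sum_derivative:
  assumes "k 0 = 0" "R \<ge> 0" "t \<ge> 0"
    and X: "\<And>n t. t \<ge> 0 \<Longrightarrow>
      (X n has_real_derivative cutoff_field k N R n (\<lambda>m. X m t)) (at t within {0..})"
    and "p \<le> N"
  shows "((\<lambda>t. \<Sum>n<p. cutoff_energy R (X (Suc n) t)) has_real_derivative
    - 2 * k p * (cutoff R (X p t))\<^sup>2 * cutoff R (X (Suc p) t)) (at t within {0..})"
  using \<open>p \<le> N\<close>
proof (induction p)
  case (Suc p)
  have "((\<lambda>t. (\<Sum>n<p. cutoff_energy R (X (Suc n) t)) + cutoff_energy R (X (Suc p) t))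
      has_real_derivative
      - 2 * k p * (cutoff R (X p t))\<^sup>2 * cutoff R (X (Suc p) t)
      + 2 * cutoff R (X (Suc p) t) * cutoff_field k N R (Suc p) (\<lambda>m. X m t)) (at t within {0..})"
    by (intro DERIV_add Suc.IH has_real_derivative_cutoff_energy X assms) (use Suc.prems in auto)
  then show ?case
    unfolding sum.lessThan_Suc
    by (rule DERIV_cong)
      (use Suc.prems in \<open>simp add: cutoff_field_def power2_eq_square algebra_simps\<close>)
qed (simp add: \<open>k 0 = 0\<close>)

text \<open>The cut-off is removed afterwards. Since \<open>X (Suc N)\<close> vanishes, the total
  \<open>cutoff_energy\<close> is constant in time and at most \<open>B^2\<close>; a component
  reaching \<open>R > B\<close> would alone contribute at least \<open>R^2\<close>.\<close>

lemma galerkin_solution_exists: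
  assumes "k 0 = 0" and k: "\<And>n. n \<ge> 1 \<Longrightarrow> 0 \<le> k n \<and> k n \<le> C * 2 ^ n"
    and x: "\<And>n. n \<ge> 1 \<Longrightarrow> x n \<ge> 0" and "B \<ge> 0" and E: "(\<Sum>n<N. (x (Suc n))\<^sup>2) \<le> B\<^sup>2"
  shows "\<exists>X. dyadic_upto k N X \<and> (\<forall>n. \<forall>t\<ge>0. X n t \<ge> 0) \<and>
    (\<forall>t\<ge>0. X 0 t = 0 \<and> X (Suc N) t = 0) \<and> (\<forall>n<N. X (Suc n) 0 = x (Suc n))"
proof -
  define R where "R = B + 1"
  have R: "R \<ge> 0" "B < R" using \<open>B \<ge> 0\<close> by (auto simp: R_def)
  have "C \<ge> 0" using k[of 1] by simp
  have K: "0 \<le> k n \<and> k n \<le> C * 2 ^ N" if "n \<le> N" for n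
  proof (cases "n = 0")
    case False
    have "C * 2 ^ n \<le> C * 2 ^ N" using \<open>C \<ge> 0\<close> that by (intro mult_left_mono power_increasing) auto
    then show ?thesis using k[of n] False by auto
  qed (use \<open>k 0 = 0\<close> \<open>C \<ge> 0\<close> in simp)
  \<comment> \<open>The entry \<open>x 0\<close> is arbitrary, so the datum is set to
    \<open>0\<close> there as well as above \<open>N\<close>.\<close>
  define y where "y n = (if 1 \<le> n \<and> n \<le> N then x n else 0)" for n
  obtain X where "\<forall>n. X n 0 = y n \<and> (\<forall>t\<ge>0. (X n has_real_derivative
      cutoff_field k N R n (\<lambda>m. X m t)) (at t within {0..}))"
    using cutoff_solution_exists[where N = N and k = k and x = y, OF K \<open>R \<ge> 0\<close>] by blast
  then have init: "\<And>n. X n 0 = y n"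
    and der: "\<And>n t. t \<ge> 0 \<Longrightarrow>
      (X n has_real_derivative cutoff_field k N R n (\<lambda>m. X m t)) (at t within {0..})"
    by blast+
  have nonneg: "X n t \<ge> 0" if "t \<ge> 0" for n t
  proof (rule nonneg_of_cutoff_solution[OF _ der _ that])
    show "X n 0 \<ge> 0" using x[of n] by (simp add: init y_def)
  qed (simp add: K)
  have outside: "X n t = 0" if "n = 0 \<or> n > N" "t \<ge> 0" for n t
  proof -
    have der0: "(X n has_real_derivative 0) (at s within {0..})" if "s \<ge> 0" for s
    proof -
      have "cutoff_field k N R n (\<lambda>m. X m s) = 0"
        using \<open>n = 0 \<or> n > N\<close> by (auto simp: cutoff_field_def)
      then show ?thesis using der[OF that, of n] by simp
    qed
    have "\<bar>X n t\<bar> \<le> 0"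
      by (rule abs_le_of_abs_deriv_le[OF der0 DERIV_const[of 0]])
        (use that in \<open>auto simp: init y_def\<close>)
    then show ?thesis by simp
  qed
  have energy_le: "(\<Sum>n<N. cutoff_energy R (X (Suc n) t)) \<le> B\<^sup>2" if "t \<ge> 0" for t
  proof -
    have der0: "((\<lambda>t. \<Sum>n<N. cutoff_energy R (X (Suc n) t)) has_real_derivative 0)
        (at s within {0..})" if "s \<ge> 0" for s
      using cutoff_energy_sum_derivative[OF \<open>k 0 = 0\<close> \<open>R \<ge> 0\<close> that der order_refl]
        outside[of "Suc N" s] that \<open>R \<ge> 0\<close>
      by (simp add: cutoff_def)
    show ?thesis
    proof (rule le_of_deriv_le[OF der0 DERIV_const[of "B\<^sup>2"] order_refl _ that])
      have "(\<Sum>n<N. cutoff_energy R (X (Suc n) 0)) \<le> (\<Sum>n<N. (x (Suc n))\<^sup>2)"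
        by (intro sum_mono) (simp add: init y_def cutoff_energy_le)
      then show "(\<Sum>n<N. cutoff_energy R (X (Suc n) 0)) \<le> B\<^sup>2" using E by linarith
    qed
  qed
  have less: "X n t < R" if "t \<ge> 0" for n t
  proof (cases "n = 0 \<or> n > N")
    case True
    then show ?thesis using outside[OF _ that] R \<open>B \<ge> 0\<close> by simp
  next
    case False
    then obtain m where m: "n = Suc m" "m < N" by (cases n) auto
    have "cutoff_energy R (X n t) \<le> (\<Sum>n<N. cutoff_energy R (X (Suc n) t))"
      unfolding m(1)
      by (rule member_le_sum[where f = "\<lambda>n. cutoff_energy R (X (Suc n) t)"])
        (use m cutoff_energy_nonneg[OF \<open>R \<ge> 0\<close>] in auto)
    also have "\<dots> \<le> B\<^sup>2" by (rule energy_le[OF that])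
    also have "\<dots> < R\<^sup>2" using R \<open>B \<ge> 0\<close> by (intro power_strict_mono) auto
    finally have energy: "cutoff_energy R (X n t) < R\<^sup>2" .
    show ?thesis
    proof (rule ccontr)
      assume "\<not> X n t < R"
      then have ge: "X n t \<ge> R" by simp
      then have "cutoff_energy R (X n t) = R\<^sup>2 + 2 * R * (X n t - R)"
        using \<open>R \<ge> 0\<close> by (simp add: cutoff_energy_def power2_eq_square algebra_simps)
      moreover have "0 \<le> 2 * R * (X n t - R)" using ge \<open>R \<ge> 0\<close> by simp
      ultimately show False using energy by linarith
    qed
  qed
  have cutoff_eq: "cutoff R (X n t) = X n t" if "t \<ge> 0" for n t
    using less[OF that, of n] nonneg[OF that, of n] by (simp add: cutoff_def)
  have "dyadic_upto k N X"
    unfolding dyadic_upto_def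
  proof (intro allI impI)
    fix n and t :: real assume "n < N" "t \<ge> 0"
    then show "(X (Suc n) has_real_derivative
        (k n * (X n t)\<^sup>2 - k (Suc n) * X (Suc n) t * X (Suc (Suc n)) t)) (at t within {0..})"
      using der[of t "Suc n"] by (simp add: cutoff_field_def cutoff_eq mult.assoc)
  qed
  moreover have "X (Suc n) 0 = x (Suc n)" if "n < N" for n
    using that by (simp add: init y_def)
  moreover have "X 0 t = 0 \<and> X (Suc N) t = 0" if "t \<ge> 0" for t
    using that by (simp add: outside)
  ultimately show ?thesis using nonneg by blast
qed

section \<open>Existence and uniqueness\<close>

text \<open>Continuity of the derivatives is automatic, as the right-hand sides are polynomials in
  finitely many continuous components.\<close>

lemma global_solutionI:
  assumes "k 0 = 0" "\<And>t. t \<ge> 0 \<Longrightarrow> X 0 t = 0"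
    and X: "\<And>N. dyadic_upto k N X" and "\<And>n. X (Suc n) 0 = x (Suc n)"
    and "\<And>t. t \<ge> 0 \<Longrightarrow> (\<lambda>n. X n t) \<in> ell2"
  shows "global_solution k x X"
proof -
  define f' where "f' = (\<lambda>n t. k (n - 1) * (X (n - 1) t)\<^sup>2 - k n * X n t * X (n + 1) t)"
  have der: "(X n has_real_derivative f' n t) (at t within {0..})" if "n \<ge> 1" "t \<ge> 0" for n t
    using dyadic_uptoD[OF X[of n], of "n - 1" t] that by (simp add: f'_def)
  have cont: "continuous_on {0..} (X n)" for n
  proof (cases "n = 0")
    case True
    have "continuous_on {0..} (X 0)"
      by (rule continuous_on_eq[OF continuous_on_const[of _ 0]]) (use assms(2) in auto)
    then show ?thesis using True by simp
  next
    case False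
    then show ?thesis by (intro continuous_on_of_has_real_derivative[OF der]) auto
  qed
  have "C1_within {0..} (X n)" if "n \<ge> 1" for n
    unfolding C1_within_def
  proof (intro exI[of _ "f' n"] conjI ballI)
    show "continuous_on {0..} (f' n)"
      unfolding f'_def by (intro continuous_intros cont)
  qed (use der that in auto)
  moreover have "\<forall>n\<ge>1. X n 0 = x n"
    using assms(4) by (auto dest!: Suc_le_D)
  ultimately show ?thesis
    unfolding dyadic_solution_def time_interval_infinity
    using der[unfolded f'_def] assms(2,5) by blast
qed

lemma global_solution_exists:
  assumes "k 0 = 0" and k: "\<And>n. n \<ge> 1 \<Longrightarrow> 0 \<le> k n \<and> k n \<le> C * 2 ^ n"
    and "x \<in> ell2" and x: "\<And>n. n \<ge> 1 \<Longrightarrow> x n \<ge> 0"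
  shows "\<exists>X. global_solution k x X"
proof -
  define B where "B = ell2_norm x"
  have "B \<ge> 0" unfolding B_def by (rule ell2_norm_nonneg[OF \<open>x \<in> ell2\<close>])
  have xE: "(\<Sum>n<N. (x (Suc n))\<^sup>2) \<le> B\<^sup>2" for N
    unfolding B_def by (rule partial_sum_square_le_ell2_norm[OF \<open>x \<in> ell2\<close>])
  have k': "k n \<ge> 0" for n using k[of n] \<open>k 0 = 0\<close> by (cases n) auto
  have "C \<ge> 0" using k[of 1] by simp
  have "\<forall>N. \<exists>X. dyadic_upto k N X \<and> (\<forall>n. \<forall>t\<ge>0. X n t \<ge> 0) \<and>
      (\<forall>t\<ge>0. X 0 t = 0 \<and> X (Suc N) t = 0) \<and> (\<forall>n<N. X (Suc n) 0 = x (Suc n))"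
    using galerkin_solution_exists[OF \<open>k 0 = 0\<close> k x \<open>B \<ge> 0\<close> xE] by blast
  then obtain G where "\<forall>N. dyadic_upto k N (G N) \<and> (\<forall>n. \<forall>t\<ge>0. G N n t \<ge> 0) \<and>
      (\<forall>t\<ge>0. G N 0 t = 0 \<and> G N (Suc N) t = 0) \<and> (\<forall>n<N. G N (Suc n) 0 = x (Suc n))"
    by (rule choice[THEN exE])
  then have G: "\<And>N. dyadic_upto k N (G N)"
    and G_nonneg: "\<And>N n t. t \<ge> 0 \<Longrightarrow> G N n t \<ge> 0"
    and G_0: "\<And>N t. t \<ge> 0 \<Longrightarrow> G N 0 t = 0"
    and G_Suc: "\<And>N t. t \<ge> 0 \<Longrightarrow> G N (Suc N) t = 0"
    and G_init: "\<And>N n. n < N \<Longrightarrow> G N (Suc n) 0 = x (Suc n)"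
    by blast+
  \<comment> \<open>Sums shorter than the order are included because \<open>G M\<close> is compared
    with \<open>G N\<close> on the first \<open>N\<close> levels only.\<close>
  have GE: "(\<Sum>n<p. (G N (Suc n) t)\<^sup>2) \<le> B\<^sup>2" if "p \<le> N" "t \<ge> 0" for p N t
  proof -
    have "(\<Sum>n<p. (G N (Suc n) t)\<^sup>2) \<le> (\<Sum>n<N. (G N (Suc n) t)\<^sup>2)"
      using that by (intro sum_mono2) auto
    also have "\<dots> \<le> (\<Sum>n<N. (G N (Suc n) 0)\<^sup>2)"
      by (rule partial_energy_antimono[OF \<open>k 0 = 0\<close> G k' G_nonneg order_refl \<open>t \<ge> 0\<close>])
    also have "\<dots> = (\<Sum>n<N. (x (Suc n))\<^sup>2)" by (simp add: G_init)
    also have "\<dots> \<le> B\<^sup>2" by (rule xE)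
    finally show ?thesis .
  qed
  have G_le: "G N (Suc n) t \<le> B" if "n \<le> N" "t \<ge> 0" for N n t
  proof (cases "n = N")
    case False
    then show ?thesis
      using le_of_partial_sum_square_le[OF GE[OF order_refl \<open>t \<ge> 0\<close>] _ \<open>B \<ge> 0\<close>, of n N] that
      by simp
  qed (use that G_Suc \<open>B \<ge> 0\<close> in simp)
  define c where "c n = 2 ^ Suc n * (2 * C * B ^ 3)" for n :: nat
  have c_nonneg: "c n \<ge> 0" for n using \<open>B \<ge> 0\<close> \<open>C \<ge> 0\<close> by (simp add: c_def)
  \<comment> \<open>The estimate of \<open>weighted_difference_bound\<close>, solved for the
    difference. It grows with \<open>T\<close>, so its value at the right end point serves the whole
    of \<open>{0..T}\<close>. For \<open>N <= n\<close> the division by zero yields the value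
    \<open>0\<close>, so the bound is claimed only from \<open>Suc n\<close> on.\<close>
  define r where "r n T N = sqrt (c n * T / real (N - n))" for n N :: nat and T
  have r_null: "r n T \<longlonglongrightarrow> 0" for n T
  proof -
    have "(\<lambda>N. c n * T / real N) \<longlonglongrightarrow> 0" by (rule lim_const_over_n)
    then have "(\<lambda>N. c n * T / real (N - n)) \<longlonglongrightarrow> 0"
      by - (rule LIMSEQ_offset[where k = n], simp)
    from tendsto_real_sqrt[OF this] show ?thesis by (simp add: r_def[abs_def])
  qed
  have cauchy: "\<bar>G N (Suc n) t - G M (Suc n) t\<bar> \<le> r n t N"
    if "Suc n \<le> N" "N \<le> M" "t \<ge> 0" for n N M t
  proof -
    have "real (N - n) * (G N (Suc n) t - G M (Suc n) t)\<^sup>2 \<le> 2 ^ Suc n * (2 * C * B ^ 3 * t)"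
    proof (rule weighted_difference_bound[OF \<open>k 0 = 0\<close> k G dyadic_upto_mono[OF G \<open>N \<le> M\<close>]])
      show "G N (Suc n) 0 = G M (Suc n) 0" if "n < N" for n
        using that \<open>N \<le> M\<close> by (simp add: G_init)
      show "0 \<le> G N (Suc n) t \<and> G N (Suc n) t \<le> B" if "n \<le> N" "t \<ge> 0" for n t
        using that by (simp add: G_le G_nonneg)
      show "0 \<le> G M (Suc n) t \<and> G M (Suc n) t \<le> B" if "n \<le> N" "t \<ge> 0" for n t
        using that \<open>N \<le> M\<close> by (simp add: G_le G_nonneg)
      show "(\<Sum>n<N. (G M (Suc n) t)\<^sup>2) \<le> B\<^sup>2" if "t \<ge> 0" for t
        by (rule GE[OF \<open>N \<le> M\<close> that])
      show "(\<Sum>n<N. (G N (Suc n) t)\<^sup>2) \<le> B\<^sup>2" if "t \<ge> 0" for t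
        by (rule GE[OF order_refl that])
    qed (use that in auto)
    then have "(G N (Suc n) t - G M (Suc n) t)\<^sup>2 \<le> c n * t / real (N - n)"
      using that by (simp add: c_def field_simps)
    then show ?thesis
      unfolding r_def by (intro real_le_rsqrt) simp
  qed
  define X where "X n t = lim (\<lambda>N. G N n t)" for n t
  have X_0: "X 0 t = 0" if "t \<ge> 0" for t
    using that by (simp add: X_def G_0)
  have lim_Suc: "(\<lambda>N. G N (Suc n) t) \<longlonglongrightarrow> X (Suc n) t" if "t \<ge> 0" for n t
    unfolding X_def by (rule abs_diff_lim_le(1)[OF cauchy r_null]) (use that in auto)
  have err: "\<bar>G N (Suc n) t - X (Suc n) t\<bar> \<le> r n t N" if "Suc n \<le> N" "t \<ge> 0" for n N t
    unfolding X_def by (rule abs_diff_lim_le(2)[OF cauchy r_null]) (use that in auto)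
  have unif: "uniform_limit {0..T} (\<lambda>N. G N n) (X n) sequentially" for n T
  proof (cases n)
    case 0
    then show ?thesis by (simp add: uniform_limit_iff X_0 G_0)
  next
    case (Suc m)
    show ?thesis
      unfolding uniform_limit_iff
    proof (intro allI impI)
      fix e :: real assume "e > 0"
      have "\<forall>\<^sub>F N in sequentially. r m T N < e \<and> Suc m \<le> N"
        using order_tendstoD(2)[OF r_null \<open>e > 0\<close>] eventually_ge_at_top
        by (rule eventually_conj)
      then show "\<forall>\<^sub>F N in sequentially. \<forall>t\<in>{0..T}. dist (G N n t) (X n t) < e"
      proof (rule eventually_mono, intro ballI)
        fix N t assume N: "r m T N < e \<and> Suc m \<le> N" and t: "t \<in> {0..T}"
        have "r m t N \<le> r m T N"
          unfolding r_def using t c_nonneg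
          by (intro real_sqrt_le_mono divide_right_mono mult_left_mono) auto
        then show "dist (G N n t) (X n t) < e"
          using err[of m N t] N t by (simp add: dist_real_def Suc)
      qed
    qed
  qed
  have lim: "(\<lambda>N. G N n t) \<longlonglongrightarrow> X n t" if "t \<ge> 0" for n t
    by (rule tendsto_uniform_limitI[OF unif[where T = t]]) (use that in auto)
  \<comment> \<open>Only finite sums are passed to the limit, each along the orders
    \<open>N >= p\<close>; the bound is uniform in \<open>p\<close>, which later gives membership in
    \<open>ell2\<close>.\<close>
  have XE: "(\<Sum>n<p. (X (Suc n) t)\<^sup>2) \<le> B\<^sup>2" if "t \<ge> 0" for p t
  proof (rule LIMSEQ_le_const2)
    show "(\<lambda>N. \<Sum>n<p. (G N (Suc n) t)\<^sup>2) \<longlonglongrightarrow> (\<Sum>n<p. (X (Suc n) t)\<^sup>2)"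
      by (intro tendsto_sum tendsto_power lim that)
    show "\<exists>N0. \<forall>N\<ge>N0. (\<Sum>n<p. (G N (Suc n) t)\<^sup>2) \<le> B\<^sup>2" using GE that by blast
  qed
  have X_nonneg: "X n t \<ge> 0" if "t \<ge> 0" for n t
    by (rule LIMSEQ_le_const[OF lim[OF that]]) (simp add: G_nonneg that)
  have X_le: "X n t \<le> B" if "t \<ge> 0" for n t
  proof (cases n)
    case (Suc m)
    show ?thesis
      unfolding Suc by (rule le_of_partial_sum_square_le[OF XE[OF that] lessI \<open>B \<ge> 0\<close>])
  qed (simp add: X_0 that \<open>B \<ge> 0\<close>)
  \<comment> \<open>Products of uniform limits converge uniformly once the limit functions are
    bounded; this is used for the quadratic right-hand sides.\<close>
  have bdd: "bounded (X n ` {0..T})" for n T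
    unfolding bounded_iff by (intro exI[of _ B]) (simp add: X_nonneg X_le)
  have const_mult: "uniform_limit {0..T} (\<lambda>N t. a * f N t) (\<lambda>t. a * g t) sequentially"
    if "uniform_limit {0..T} f g sequentially" for a T and f :: "nat \<Rightarrow> real \<Rightarrow> real" and g
    using bounded_linear.uniform_limit[OF bounded_linear_mult_right that] .
  have "dyadic_upto k N X" for N
    unfolding dyadic_upto_def
  proof (intro allI impI)
    fix n and t :: real assume "t \<ge> 0"
    show "(X (Suc n) has_real_derivative
        (k n * (X n t)\<^sup>2 - k (Suc n) * X (Suc n) t * X (Suc (Suc n)) t)) (at t within {0..})"
    proof (rule has_real_derivative_local_uniform_limit[OF _ lim _ \<open>t \<ge> 0\<close>])
      show "\<forall>\<^sub>F N in sequentially. \<forall>t\<ge>0. (G N (Suc n) has_real_derivative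
          (k n * (G N n t)\<^sup>2 - k (Suc n) * G N (Suc n) t * G N (Suc (Suc n)) t)) (at t within {0..})"
        using eventually_gt_at_top[of n]
        by eventually_elim (auto intro: dyadic_uptoD[OF G])
      show "uniform_limit {0..T}
          (\<lambda>N t. k n * (G N n t)\<^sup>2 - k (Suc n) * G N (Suc n) t * G N (Suc (Suc n)) t)
          (\<lambda>t. k n * (X n t)\<^sup>2 - k (Suc n) * X (Suc n) t * X (Suc (Suc n)) t) sequentially" for T
        unfolding power2_eq_square mult.assoc
        by (intro uniform_limit_minus const_mult uniform_lim_mult unif bdd)
    qed
  qed
  moreover have "X (Suc n) 0 = x (Suc n)" for n
  proof (rule LIMSEQ_unique[OF lim])
    have "\<forall>\<^sub>F N in sequentially. x (Suc n) = G N (Suc n) 0"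
      using eventually_gt_at_top[of n] by eventually_elim (simp add: G_init)
    then show "(\<lambda>N. G N (Suc n) 0) \<longlonglongrightarrow> x (Suc n)" by (rule Lim_transform_eventually[OF tendsto_const])
  qed simp
  moreover have "(\<lambda>n. X n t) \<in> ell2" if "t \<ge> 0" for t
    by (rule ell2_norm_leI(1)[of _ B]) (simp_all add: XE that \<open>B \<ge> 0\<close>)
  ultimately show ?thesis using global_solutionI[of k X x] \<open>k 0 = 0\<close> X_0 by blast
qed

theorem corollary1p7:
  fixes k :: "nat \<Rightarrow> real" and C :: real and x :: "nat \<Rightarrow> real"
  assumes "k 0 = 0"
    and "\<And>n. n \<ge> 1 \<Longrightarrow> 0 \<le> k n \<and> k n \<le> C * 2 ^ n"
    and "x \<in> ell2"
    and "\<And>n. n \<ge> 1 \<Longrightarrow> x n \<ge> 0"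
  shows "\<exists>X. global_solution k x X \<and>
           (\<forall>Y. global_solution k x Y \<longrightarrow> (\<forall>n\<ge>1. \<forall>t\<ge>0. Y n t = X n t)) \<and>
           leray_hopf_solution k \<infinity> x X"
proof -
  obtain X where X: "global_solution k x X"
    using global_solution_exists[OF assms] by blast
  have "leray_hopf_solution k \<infinity> x X"
    by (rule global_solution_leray_hopf[OF assms(1) _ X assms(4)]) (use assms(2) in blast)
  then show ?thesis
    using X global_solution_unique[OF assms X] by blast
qed

end
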